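(* Let $\sigma$ be a finite positive Radon measure on $[0,1)$ and let $C := 1 + \sigma([0,1))$. Let $\mu$ be the signed measure on $[0,1]$ defined by $\mu = C\delta_1 - \sigma$, where $\delta_1$ is the Dirac measure at $1$. Let $\gamma = (\gamma_n)_{n=0}^\infty$, $\gamma_n = \int t^n \, d\mu(t)$, be the sequence of moments of $\mu$, and let $W_\alpha$ be the weighted shift with weight sequence $\alpha_n = \sqrt{\gamma_{n+1}/\gamma_n}$, $n = 0,1,2,\ldots$. Then $W_\alpha$ is completely hyperexpansive. Further, in the Lévy–Khinchin representation $$\gamma_n = a + b n + \int_{[0,1)} (1-t^n)\, d\nu(t) \quad (n = 0,1,2,\ldots)$$ of $\gamma$ (with $b \ge 0$ and $\nu$ a positive Radon measure on $[0,1)$), one has $\nu = \sigma$, $a = 1$, and $b = 0$.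
   Context: For a positive weight sequence $\alpha = (\alpha_n)_{n\ge 0}$, the weighted shift $W_\alpha$ acts on $\ell^2$ with standard basis $\{e_j\}_{j\ge0}$ by $W_\alpha e_j = \alpha_j e_{j+1}$; its moments are $\gamma_0 = 1$ and $\gamma_j = \prod_{i=0}^{j-1}\alpha_i^2$ for $j \ge 1$. For a sequence $c$, set $(\Delta c)_n = c_{n+1} - c_n$ and $\nabla = -\Delta$, with iterates $\Delta^k$, $\nabla^k$ (and $\Delta^0$, $\nabla^0$ the identity). A sequence $c$ is completely monotone if $(\nabla^k c)_n \ge 0$ for all $n,k \ge 0$. A sequence $c$ is completely alternating if $\Delta c$ is completely monotone, i.e. $(\nabla^k c)_n \le 0$ for all $k\ge 1$, $n \ge 0$. A weighted shift is completely hyperexpansive (CHE) if its moment sequence is completely alternating. The convention $0^0 = 1$ is used. Every completely alternating sequence $\gamma$ has a Lévy–Khinchin representation of the displayed form with $a = \gamma_0$. *)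

theory Defs
  imports "HOL-Probability.Probability"
begin

definition fdiff :: "(nat \<Rightarrow> real) \<Rightarrow> nat \<Rightarrow> real" where
  "fdiff c = (\<lambda>n. c (Suc n) - c n)"

definition nabla :: "(nat \<Rightarrow> real) \<Rightarrow> nat \<Rightarrow> real" where
  "nabla c = (\<lambda>n. - fdiff c n)"

definition completely_monotone :: "(nat \<Rightarrow> real) \<Rightarrow> bool" where
  "completely_monotone c \<longleftrightarrow> (\<forall>k n. 0 \<le> (nabla ^^ k) c n)"

definition completely_alternating :: "(nat \<Rightarrow> real) \<Rightarrow> bool" where
  "completely_alternating c \<longleftrightarrow> completely_monotone (fdiff c)"

definition ell2 :: "(nat \<Rightarrow> complex) set" where
  "ell2 = {x. summable (\<lambda>n. (cmod (x n))\<^sup>2)}"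

text \<open>The coordinate form of the operator sending the \<open>j\<close>-th basis vector to \<open>\<alpha> j\<close> times the
  \<open>(j+1)\<close>-st one.\<close>

definition weighted_shift :: "(nat \<Rightarrow> real) \<Rightarrow> (nat \<Rightarrow> complex) \<Rightarrow> (nat \<Rightarrow> complex)" where
  "weighted_shift \<alpha> x = (\<lambda>n. case n of 0 \<Rightarrow> 0 | Suc m \<Rightarrow> complex_of_real (\<alpha> m) * x m)"

definition shift_moment :: "(nat \<Rightarrow> real) \<Rightarrow> nat \<Rightarrow> real" where
  "shift_moment \<alpha> j = (\<Prod>i<j. (\<alpha> i)\<^sup>2)"

text \<open>The weight sequence is determined by the operator, so the existential quantifier involves
  no choice. Mapping \<open>ell2\<close> into itself is what makes the shift an (everywhere defined, hence
  bounded) operator on \<open>ell2\<close>.\<close>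

definition completely_hyperexpansive_shift ::
    "((nat \<Rightarrow> complex) \<Rightarrow> (nat \<Rightarrow> complex)) \<Rightarrow> bool" where
  "completely_hyperexpansive_shift T \<longleftrightarrow>
     (\<exists>\<alpha>. (\<forall>n. 0 < \<alpha> n) \<and> T = weighted_shift \<alpha> \<and> T ` ell2 \<subseteq> ell2 \<and>
          completely_alternating (shift_moment \<alpha>))"

abbreviation borel_on :: "real set \<Rightarrow> real measure" where
  "borel_on S \<equiv> restrict_space borel S"

text \<open>Finiteness is required only on compact subsets of \<open>S\<close>, so on \<open>{0..<1}\<close> a Radon measure may
  have infinite mass near \<open>1\<close>.\<close>

definition radon_measure_on :: "real set \<Rightarrow> real measure \<Rightarrow> bool" where
  "radon_measure_on S M \<longleftrightarrow>
     sets M = sets (borel_on S) \<and>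
     (\<forall>K. compact K \<and> K \<subseteq> S \<longrightarrow> emeasure M K < \<infinity>) \<and>
     (\<forall>A\<in>sets M. emeasure M A = (SUP K\<in>{K. compact K \<and> K \<subseteq> A}. emeasure M K))"

text \<open>A finite signed measure on the measurable space \<open>M\<close> is given by its real values on
  \<open>sets M\<close>. The measure carried by \<open>M\<close> itself is irrelevant. The pair \<open>(P, N)\<close> below is unique
  when it exists.\<close>

definition jordan_decomposition ::
    "'a measure \<Rightarrow> ('a set \<Rightarrow> real) \<Rightarrow> 'a measure \<Rightarrow> 'a measure \<Rightarrow> bool" where
  "jordan_decomposition M \<mu> P N \<longleftrightarrow>
     sets P = sets M \<and> sets N = sets M \<and> finite_measure P \<and> finite_measure N \<and>
     (\<exists>D\<in>sets M. emeasure N D = 0 \<and> emeasure P (space M - D) = 0) \<and>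
     (\<forall>A\<in>sets M. \<mu> A = measure P A - measure N A)"

definition signed_integral ::
    "'a measure \<Rightarrow> ('a set \<Rightarrow> real) \<Rightarrow> ('a \<Rightarrow> real) \<Rightarrow> real" where
  "signed_integral M \<mu> f =
     (THE I. \<exists>P N. jordan_decomposition M \<mu> P N \<and>
                   I = integral\<^sup>L P f - integral\<^sup>L N f)"

text \<open>Integrability is required explicitly: \<open>\<nu>\<close> may be infinite, and the Bochner integral of a
  non-integrable function is \<open>0\<close>.\<close>

definition levy_khinchin :: "(nat \<Rightarrow> real) \<Rightarrow> real \<Rightarrow> real \<Rightarrow> real measure \<Rightarrow> bool" where
  "levy_khinchin \<gamma> a b \<nu> \<longleftrightarrow>
     0 \<le> b \<and> radon_measure_on {0..<1} \<nu> \<and>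
     (\<forall>n. integrable \<nu> (\<lambda>t. 1 - t ^ n) \<and>
          \<gamma> n = a + b * real n + (LINT t|\<nu>. 1 - t ^ n))"

end

theory Submission
  imports Defs
begin

text \<open>Since \<open>\<mu>\<close> has Jordan decomposition \<open>(C \<delta>\<^sub>1, \<sigma>)\<close>, its moments are
  \<open>\<gamma>\<^sub>n = 1 + \<integral> (1 - t^n) d\<sigma> \<in> [1, C]\<close>. The differences
  \<open>\<Delta>\<gamma>\<^sub>n = \<integral> t^n (1 - t) d\<sigma>\<close> are moments of a finite positive measure,
  whence complete alternation. Given any representation of \<open>\<gamma>\<close>, \<open>n = 0\<close> yields \<open>a = 1\<close>, letting
  \<open>n \<rightarrow> \<infinity>\<close> in \<open>\<Delta>\<gamma>\<^sub>n = b + \<integral> t^n (1 - t) d\<nu>\<close> yields \<open>b = 0\<close>, and then the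
  finite measures \<open>(1 - t) d\<sigma>\<close> and \<open>(1 - t) d\<nu>\<close> have the same moments; they coincide by the
  Weierstrass theorem, and dividing by \<open>1 - t > 0\<close> gives \<open>\<nu> = \<sigma>\<close>.\<close>

section \<open>Borel measures on a subset of the line\<close>

lemma borel_measurable_borel_on:
  assumes "sets M = sets (borel_on S)" and "f \<in> borel_measurable borel"
  shows "f \<in> borel_measurable M"
  using assms measurable_restrict_space1 by (metis measurable_cong_sets)

lemma space_borel_on:
  assumes "sets M = sets (borel_on S)"
  shows "space M = S"
  using sets_eq_imp_space_eq[OF assms] by (simp add: space_restrict_space)

lemma (in finite_measure) integrable_bounded_on_space:
  fixes p :: "'a \<Rightarrow> real"
  assumes "p \<in> borel_measurable M" "\<And>t. t \<in> space M \<Longrightarrow> \<bar>p t\<bar> \<le> B"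
  shows "integrable M p"
  using assms by (intro integrable_const_bound[of _ B]) auto

section \<open>Jordan decompositions and the signed integral\<close>

text \<open>The positive part is minimal: as \<open>D\<close> carries \<open>P\<close> and is null
  for \<open>N\<close>, \<open>P A\<close> equals \<open>\<mu> (A \<inter> D)\<close>, and dropping
  the subtracted term \<open>N' (A \<inter> D)\<close> can only increase this value. Minimality in
  both directions yields uniqueness.\<close>

lemma jordan_decomposition_positive_le:
  assumes PN: "jordan_decomposition M \<mu> P N" and PN': "jordan_decomposition M \<mu> P' N'"
    and A: "A \<in> sets M"
  shows "measure P A \<le> measure P' A"
proof -
  obtain D where D: "D \<in> sets M" "emeasure N D = 0" "emeasure P (space M - D) = 0"
    using PN unfolding jordan_decomposition_def by auto
  have s: "sets P = sets M" "sets N = sets M" "sets P' = sets M"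
    and mu: "\<And>A. A \<in> sets M \<Longrightarrow> \<mu> A = measure P A - measure N A"
      "\<And>A. A \<in> sets M \<Longrightarrow> \<mu> A = measure P' A - measure N' A"
    using PN PN' unfolding jordan_decomposition_def by auto
  interpret P: finite_measure P using PN unfolding jordan_decomposition_def by auto
  interpret P': finite_measure P' using PN' unfolding jordan_decomposition_def by auto
  have AD: "A \<inter> D \<in> sets M" "A - D \<in> sets M" using A D by auto
  have "emeasure P (A - D) \<le> emeasure P (space M - D)"
    using A D sets.sets_into_space[OF A] s by (intro emeasure_mono) auto
  hence "measure P (A - D) = 0" using D by (simp add: measure_def)
  moreover have "measure P A = measure P (A \<inter> D) + measure P (A - D)"
    using P.finite_measure_Union[of "A \<inter> D" "A - D"] AD s by (auto simp: Int_Diff_Un)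
  moreover have "emeasure N (A \<inter> D) \<le> emeasure N D"
    using D s by (intro emeasure_mono) auto
  hence "measure N (A \<inter> D) = 0" using D by (simp add: measure_def)
  ultimately have "measure P A = measure P' (A \<inter> D) - measure N' (A \<inter> D)"
    using mu[OF AD(1)] by simp
  also have "\<dots> \<le> measure P' (A \<inter> D)" by simp
  also have "\<dots> \<le> measure P' A" using A s by (intro P'.finite_measure_mono) auto
  finally show ?thesis .
qed

lemma jordan_decomposition_unique:
  assumes PN: "jordan_decomposition M \<mu> P N" and PN': "jordan_decomposition M \<mu> P' N'"
  shows "P = P'" "N = N'"
proof -
  have s: "sets P = sets M" "sets N = sets M" "sets P' = sets M" "sets N' = sets M"
    and mu: "\<And>A. A \<in> sets M \<Longrightarrow> \<mu> A = measure P A - measure N A"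
      "\<And>A. A \<in> sets M \<Longrightarrow> \<mu> A = measure P' A - measure N' A"
    and fin: "finite_measure P" "finite_measure N" "finite_measure P'" "finite_measure N'"
    using PN PN' unfolding jordan_decomposition_def by auto
  have eq: "measure P A = measure P' A" if "A \<in> sets M" for A
    using jordan_decomposition_positive_le[OF PN PN' that]
      jordan_decomposition_positive_le[OF PN' PN that] by simp
  show "P = P'"
    using eq s fin by (intro measure_eqI) (auto simp: finite_measure.emeasure_eq_measure)
  show "N = N'"
    using eq mu s fin by (intro measure_eqI) (auto simp: finite_measure.emeasure_eq_measure)
qed

text \<open>Uniqueness of the decomposition makes the definite description denote a value,
  computable from whichever decomposition is at hand.\<close>

lemma signed_integral_eq:
  assumes "jordan_decomposition M \<mu> P N"
  shows "signed_integral M \<mu> f = integral\<^sup>L P f - integral\<^sup>L N f"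
  unfolding signed_integral_def
  using assms jordan_decomposition_unique[OF _ assms] by (intro the_equality) blast+

text \<open>The set \<open>{1}\<close> separates the two parts: the point mass lives on it, while
  \<sigma> lives on \<open>{0..<1}\<close> and does not charge it. The image under the identity
  places \<sigma> on the Borel sets of \<open>{0..1}\<close>, where both parts must be
  defined.\<close>

lemma jordan_decomposition_dirac_minus:
  fixes \<sigma> :: "real measure"
  assumes s: "sets \<sigma> = sets (borel_on {0..<1})" and fin: "finite_measure \<sigma>" and C: "0 \<le> C"
  shows "jordan_decomposition (borel_on {0..1})
           (\<lambda>A. C * measure (return (borel_on {0..1}) 1) A - measure \<sigma> (A \<inter> {0..<1}))
           (density (return (borel_on {0..1}) 1) (\<lambda>_. ennreal C))
           (distr \<sigma> (borel_on {0..1}) (\<lambda>t. t))"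
proof -
  have sp: "space \<sigma> = {0..<1}" by (rule space_borel_on[OF s])
  have id: "(\<lambda>t. t) \<in> measurable \<sigma> (borel_on {0..1})"
    using borel_measurable_borel_on[OF s, of "\<lambda>t. t"] sp
    by (intro measurable_restrict_space2) auto
  have D: "{1} \<in> sets (borel_on {0..1::real})" "{0..1} - {1} \<in> sets (borel_on {0..1::real})"
    by (auto simp: sets_restrict_space_iff)
  interpret finite_measure \<sigma> by (rule fin)
  have prob: "prob_space (return (borel_on {0..1}) (1::real))"
    by (intro prob_space_return) (simp add: space_restrict_space)
  then interpret R: prob_space "return (borel_on {0..1}) (1::real)" .
  have "finite_measure (density (return (borel_on {0..1}) (1::real)) (\<lambda>_. ennreal C))"
    using R.emeasure_space_1 sets.top[of "return (borel_on {0..1}) (1::real)"]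
    by (intro finite_measureI)
      (simp add: emeasure_density_const ennreal_mult_eq_top_iff del: space_return sets.top)
  moreover have "emeasure (distr \<sigma> (borel_on {0..1}) (\<lambda>t. t)) {1} = 0"
    using id D sp by (simp add: emeasure_distr)
  moreover have "emeasure (density (return (borel_on {0..1}) (1::real)) (\<lambda>_. ennreal C))
      (space (borel_on {0..1}) - {1}) = 0"
    using D by (simp add: emeasure_density_const space_restrict_space)
  ultimately show ?thesis
    unfolding jordan_decomposition_def using id D C finite_measure_distr[OF id]
    by (auto simp: measure_density_const measure_distr sp)
qed

lemma signed_integral_dirac_minus:
  fixes \<sigma> :: "real measure"
  assumes s: "sets \<sigma> = sets (borel_on {0..<1})" and fin: "finite_measure \<sigma>" and C: "0 \<le> C"
    and f: "f \<in> borel_measurable borel"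
  shows "signed_integral (borel_on {0..1})
           (\<lambda>A. C * measure (return (borel_on {0..1}) 1) A - measure \<sigma> (A \<inter> {0..<1})) f
         = C * f 1 - (LINT t|\<sigma>. f t)"
proof -
  have id: "(\<lambda>t. t) \<in> measurable \<sigma> (borel_on {0..1})"
    using borel_measurable_borel_on[OF s, of "\<lambda>t. t"] space_borel_on[OF s]
    by (intro measurable_restrict_space2) auto
  have f': "f \<in> borel_measurable (borel_on {0..1})"
    using f by (rule measurable_restrict_space1)
  have "integral\<^sup>L (density (return (borel_on {0..1}) 1) (\<lambda>_. ennreal C)) f = C * f 1"
    using f' C by (subst integral_density) (auto simp: integral_return space_restrict_space)
  moreover have "integral\<^sup>L (distr \<sigma> (borel_on {0..1}) (\<lambda>t. t)) f = (LINT t|\<sigma>. f t)"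
    by (rule integral_distr[OF id f'])
  ultimately show ?thesis
    using signed_integral_eq[OF jordan_decomposition_dirac_minus[OF s fin C]] by simp
qed

section \<open>Finite measures on the unit interval are determined by their moments\<close>

text \<open>Equal moments give equal integrals of polynomials, and by Weierstrass these approximate
  \<open>f\<close> uniformly on \<open>{0..1}\<close>, which carries both measures. The global bound
  on \<open>f\<close> secures its integrability.\<close>

lemma integral_moments_eq_imp_integral_eq:
  fixes M N :: "real measure" and f :: "real \<Rightarrow> real"
  assumes "finite_measure M" "finite_measure N"
    and sets[measurable_cong]: "sets M = sets borel" "sets N = sets borel"
    and AE: "AE t in M. t \<in> {0..1}" "AE t in N. t \<in> {0..1}"
    and moments: "\<And>n. (LINT t|M. t ^ n) = (LINT t|N. t ^ n)"
    and f: "continuous_on UNIV f" "\<And>t. \<bar>f t\<bar> \<le> B"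
  shows "integral\<^sup>L M f = integral\<^sup>L N f"
proof -
  interpret M: finite_measure M by fact
  interpret N: finite_measure N by fact
  have [measurable]: "f \<in> borel_measurable borel" using f(1) by (rule borel_measurable_continuous_onI)
  \<comment> \<open>A polynomial within \<open>e\<close> of \<open>f\<close> on
    \<open>{0..1}\<close> has the same integral for \<open>M\<close> and \<open>N\<close>, so each
    measure contributes an error of at most \<open>e\<close> times its total mass.\<close>
  have le: "\<bar>integral\<^sup>L M f - integral\<^sup>L N f\<bar>
      \<le> e * (measure M (space M) + measure N (space N))" if e: "0 < e" for e :: real
  proof -
    obtain g where g: "real_polynomial_function g" "\<And>t. t \<in> {0..1} \<Longrightarrow> \<bar>f t - g t\<bar> < e"
      using Stone_Weierstrass_real_polynomial_function[OF compact_Icc, of 0 1 f e] e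
        continuous_on_subset[OF f(1)] by (metis top_greatest)
    then obtain a n where gs: "g = (\<lambda>t. \<Sum>i\<le>n. a i * t ^ i)"
      unfolding real_polynomial_function_iff_sum by auto
    have pw: "\<bar>t ^ i\<bar> \<le> 1" if "t \<in> {0..1}" for t :: real and i
      using that by (auto simp: power_le_one)
    have pM: "integrable M (\<lambda>t. t ^ i)" for i
      using AE(1) pw by (intro M.integrable_const_bound[of _ 1]) auto
    have pN: "integrable N (\<lambda>t. t ^ i)" for i
      using AE(2) pw by (intro N.integrable_const_bound[of _ 1]) auto
    have gM: "integrable M g" and gN: "integrable N g" using pM pN by (auto simp: gs)
    have fM: "integrable M f" using f(2) by (intro M.integrable_const_bound[of _ B]) auto
    have fN: "integrable N f" using f(2) by (intro N.integrable_const_bound[of _ B]) auto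
    have geq: "integral\<^sup>L M g = integral\<^sup>L N g"
      using pM pN moments by (simp add: gs)
    have "\<bar>LINT t|M. f t - g t\<bar> \<le> (LINT t|M. e)"
      using AE(1) g(2) fM gM
      by (intro order_trans[OF integral_abs_bound] integral_mono_AE) (auto intro: less_imp_le)
    moreover have "\<bar>LINT t|N. f t - g t\<bar> \<le> (LINT t|N. e)"
      using AE(2) g(2) fN gN
      by (intro order_trans[OF integral_abs_bound] integral_mono_AE) (auto intro: less_imp_le)
    ultimately show ?thesis using fM fN gM gN geq by (simp add: algebra_simps)
  qed
  \<comment> \<open>The summand 1 keeps \<open>K\<close> positive even if both measures vanish; the
    total mass is then \<open>K - 1\<close>, below \<open>K\<close>.\<close>
  define K where "K = measure M (space M) + measure N (space N) + 1"
  have K: "K > 0" unfolding K_def by (simp add: add_nonneg_pos)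
  have "\<bar>integral\<^sup>L M f - integral\<^sup>L N f\<bar> \<le> 0"
  proof (rule field_le_epsilon)
    fix e :: real assume "0 < e"
    then have "\<bar>integral\<^sup>L M f - integral\<^sup>L N f\<bar> \<le> e / K * (K - 1)"
      using le[of "e / K"] K by (simp add: K_def)
    also have "\<dots> \<le> 0 + e" using K \<open>0 < e\<close> by (simp add: field_simps)
    finally show "\<bar>integral\<^sup>L M f - integral\<^sup>L N f\<bar> \<le> 0 + e" .
  qed
  then show ?thesis by simp
qed

text \<open>The ramp is 0 up to and including \<open>x\<close>, rises with slope \<open>k\<close>
  and is capped at 1. For \<open>t\<close> beyond \<open>x\<close> it equals 1 from some
  \<open>k\<close> on, so the limit is the indicator of the open half-line.\<close>

lemma ramp_tendsto_indicator:
  fixes x t :: real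
  shows "(\<lambda>k. min 1 (max 0 (real k * (t - x)))) \<longlonglongrightarrow> indicator {x<..} t"
proof (cases "x < t")
  case True
  then obtain K where K: "1 \<le> real K * (t - x)"
    using reals_Archimedean3[of "t - x"] by (metis diff_gt_0_iff_gt less_imp_le)
  have "eventually (\<lambda>k. min 1 (max 0 (real k * (t - x))) = 1) sequentially"
    unfolding eventually_sequentially
  proof (intro exI[of _ K] allI impI)
    fix k assume "K \<le> k"
    then have "real K * (t - x) \<le> real k * (t - x)"
      using True by (intro mult_right_mono) auto
    then show "min 1 (max 0 (real k * (t - x))) = 1" using K by linarith
  qed
  then show ?thesis using True by (simp add: tendsto_eventually)
next
  case False
  then have "max 0 (real k * (t - x)) = 0" for k
    by (simp add: max_absorb1 mult_nonneg_nonpos)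
  then show ?thesis using False by simp
qed

text \<open>Open half-lines determine a Borel measure that is finite on them. The continuous ramps
  have equal integrals, and dominated convergence with the constant bound 1 passes this on to the
  half-lines.\<close>

lemma measure_eqI_moments:
  fixes M N :: "real measure"
  assumes "finite_measure M" "finite_measure N"
    and sets[measurable_cong]: "sets M = sets borel" "sets N = sets borel"
    and AE: "AE t in M. t \<in> {0..1}" "AE t in N. t \<in> {0..1}"
    and moments: "\<And>n. (LINT t|M. t ^ n) = (LINT t|N. t ^ n)"
  shows "M = N"
proof (rule measure_eqI_lessThan)
  interpret M: finite_measure M by fact
  interpret N: finite_measure N by fact
  fix x :: real
  show "emeasure M {x<..} < \<infinity>" by (simp add: less_top[symmetric])
  define r where "r k t = min 1 (max 0 (real k * (t - x)))" for k t
  have r: "continuous_on UNIV (r k)" "\<bar>r k t\<bar> \<le> 1" for k t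
    unfolding r_def by (auto intro!: continuous_intros)
  have [measurable]: "r k \<in> borel_measurable borel" for k
    using r(1) by (rule borel_measurable_continuous_onI)
  have lim: "(\<lambda>k. r k t) \<longlonglongrightarrow> indicator {x<..} t" for t
    unfolding r_def by (rule ramp_tendsto_indicator)
  have "(\<lambda>k. integral\<^sup>L M (r k)) \<longlonglongrightarrow> (LINT t|M. indicator {x<..} t)"
    using lim r(2) by (intro integral_dominated_convergence[where w="\<lambda>_. 1"]) auto
  moreover have "(\<lambda>k. integral\<^sup>L N (r k)) \<longlonglongrightarrow> (LINT t|N. indicator {x<..} t)"
    using lim r(2) by (intro integral_dominated_convergence[where w="\<lambda>_. 1"]) auto
  moreover have "integral\<^sup>L M (r k) = integral\<^sup>L N (r k)" for k
    by (rule integral_moments_eq_imp_integral_eq[OF assms r])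
  ultimately have "(LINT t|M. indicator {x<..} t) = (LINT t|N. indicator {x<..} t :: real)"
    using LIMSEQ_unique by auto
  then show "emeasure M {x<..} = emeasure N {x<..}"
    using sets by (simp add: M.emeasure_eq_measure N.emeasure_eq_measure sets_eq_imp_space_eq)
qed (fact sets)+

section \<open>Uniqueness of the Levy-Khinchin representation\<close>

text \<open>The measures may have infinite mass near 1, but the weight \<open>1 - t\<close> makes
  them finite, so moment uniqueness applies to the weighted measures. The weight is positive on
  \<open>{0..<1}\<close> and can be divided out afterwards.\<close>

lemma measure_eqI_weighted_moments:
  fixes \<sigma> \<nu> :: "real measure"
  assumes s: "sets \<sigma> = sets (borel_on {0..<1})" "sets \<nu> = sets (borel_on {0..<1})"
    and int: "integrable \<sigma> (\<lambda>t. 1 - t)" "integrable \<nu> (\<lambda>t. 1 - t)"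
    and moments: "\<And>n. (LINT t|\<sigma>. t ^ n * (1 - t)) = (LINT t|\<nu>. t ^ n * (1 - t))"
  shows "\<nu> = \<sigma>"
proof -
  \<comment> \<open>\<open>W M\<close> is the weighted measure on \<open>{0..<1}\<close>;
    \<open>B M\<close> is the same measure viewed on the whole line, as moment uniqueness
    requires.\<close>
  define W where "W M = density M (\<lambda>t. ennreal (1 - t))" for M :: "real measure"
  define B where "B M = distr (W M) borel (\<lambda>t. t)" for M :: "real measure"
  have props: "finite_measure (B M) \<and> (AE t in B M. t \<in> {0..1}) \<and>
      (\<forall>n. (LINT t|B M. t ^ n) = (LINT t|M. t ^ n * (1 - t))) \<and>
      (\<forall>A\<in>sets M. emeasure (B M) A = emeasure (W M) A) \<and>
      density (W M) (\<lambda>t. ennreal (1 / (1 - t))) = M"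
    if sM: "sets M = sets (borel_on {0..<1})" and intM: "integrable M (\<lambda>t. 1 - t)" for M
  proof -
    have sp: "space M = {0..<1}" by (rule space_borel_on[OF sM])
    note meas = borel_measurable_borel_on[OF sM]
    have id: "(\<lambda>t. t) \<in> borel_measurable (W M)"
      using meas[of "\<lambda>t. t"] by (simp add: W_def)
    have m1: "(\<lambda>t. ennreal (1 - t)) \<in> borel_measurable M"
      "(\<lambda>t. ennreal (1 / (1 - t))) \<in> borel_measurable M"
      by (auto intro!: meas)
    have "finite_measure (W M)"
    proof
      have "emeasure (W M) (space (W M)) = (\<integral>\<^sup>+t. ennreal (1 - t) \<partial>M)"
        using m1 by (simp add: W_def emeasure_density cong: nn_integral_cong)
      also have "\<dots> = ennreal (LINT t|M. 1 - t)"
        using intM sp by (intro nn_integral_eq_integral) auto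
      finally show "emeasure (W M) (space (W M)) \<noteq> \<infinity>" by simp
    qed
    then have "finite_measure (B M)"
      using id unfolding B_def by (rule finite_measure.finite_measure_distr)
    moreover have "AE t in B M. t \<in> {0..1}"
    proof -
      have "AE t in W M. t \<in> {0..1}" by (rule AE_I2) (simp add: W_def sp)
      then show ?thesis unfolding B_def by (subst AE_distr_iff[OF id]) auto
    qed
    moreover have "(LINT t|B M. t ^ n) = (LINT t|M. t ^ n * (1 - t))" for n
    proof -
      have "(LINT t|B M. t ^ n) = (LINT t|W M. t ^ n)"
        unfolding B_def by (rule integral_distr[OF id]) simp
      also have "\<dots> = (LINT t|M. (1 - t) *\<^sub>R t ^ n)"
        unfolding W_def using sp by (intro integral_density meas) auto
      finally show ?thesis by (simp add: mult.commute)
    qed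
    moreover have "emeasure (B M) A = emeasure (W M) A" if "A \<in> sets M" for A
    proof -
      \<comment> \<open>Measurable subsets of \<open>{0..<1}\<close> are themselves Borel sets of
        the line, so passing to \<open>B M\<close> loses no information about
        \<open>W M\<close>.\<close>
      have "A \<in> sets borel" "A \<subseteq> {0..<1}"
        using that sM by (auto simp: sets_restrict_space_iff)
      moreover from this have "A \<inter> space (W M) = A" by (simp add: W_def sp Int_absorb2)
      ultimately show ?thesis unfolding B_def using id by (simp add: emeasure_distr)
    qed
    moreover have "density (W M) (\<lambda>t. ennreal (1 / (1 - t))) = M"
    proof -
      have "density (W M) (\<lambda>t. ennreal (1 / (1 - t)))
          = density M (\<lambda>t. ennreal (1 - t) * ennreal (1 / (1 - t)))"
        unfolding W_def using m1 by (rule density_density_eq)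
      also have "\<dots> = density M (\<lambda>_. 1)"
        using m1 sp by (intro density_cong) (auto simp: ennreal_mult[symmetric] intro!: AE_I2)
      finally show ?thesis by (simp add: density_1)
    qed
    ultimately show ?thesis by blast
  qed
  note ps = props[OF s(1) int(1)] and pn = props[OF s(2) int(2)]
  have "B \<sigma> = B \<nu>"
    using ps pn moments by (intro measure_eqI_moments) (auto simp: B_def)
  then have "W \<sigma> = W \<nu>"
    using ps pn s by (intro measure_eqI) (auto simp: W_def)
  then show ?thesis using ps pn by metis
qed

text \<open>Since \<open>t\<close> stays below 1 on the space, the integrands tend to 0 pointwise,
  and the integrable function \<open>1 - t\<close> dominates them all.\<close>

lemma weighted_moments_tendsto_0:
  fixes M :: "real measure"
  assumes s: "sets M = sets (borel_on {0..<1})" and int: "integrable M (\<lambda>t. 1 - t)"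
  shows "(\<lambda>n. LINT t|M. t ^ n * (1 - t)) \<longlonglongrightarrow> 0"
proof -
  have sp: "space M = {0..<1}" by (rule space_borel_on[OF s])
  note meas = borel_measurable_borel_on[OF s]
  have "(\<lambda>n. LINT t|M. t ^ n * (1 - t)) \<longlonglongrightarrow> (LINT t|M. 0)"
  proof (rule integral_dominated_convergence[OF _ _ int])
    show "AE t in M. (\<lambda>n. t ^ n * (1 - t)) \<longlonglongrightarrow> 0"
      using sp by (intro AE_I2 tendsto_mult_left_zero LIMSEQ_realpow_zero) auto
    show "AE t in M. norm (t ^ n * (1 - t)) \<le> 1 - t" for n
      using sp by (intro AE_I2) (auto simp: abs_mult mult_left_le_one_le power_le_one)
  qed (auto intro!: meas)
  then show ?thesis by simp
qed

text \<open>Integrability is stated for \<open>1 - t ^ n\<close> because \<open>t ^ n\<close> itself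
  need not be integrable when the mass is infinite.\<close>

lemma fdiff_integral_one_minus_power:
  fixes M :: "real measure"
  assumes "\<And>n. integrable M (\<lambda>t. 1 - t ^ n)"
  shows "(LINT t|M. 1 - t ^ Suc n) - (LINT t|M. 1 - t ^ n) = (LINT t|M. t ^ n * (1 - t))"
proof -
  have "(LINT t|M. 1 - t ^ Suc n) - (LINT t|M. 1 - t ^ n)
      = (LINT t|M. (1 - t ^ Suc n) - (1 - t ^ n))"
    by (rule Bochner_Integration.integral_diff[symmetric]) (rule assms)+
  then show ?thesis by (simp add: algebra_simps)
qed

lemma levy_khinchin_unique:
  assumes lk: "levy_khinchin \<gamma> a b \<nu>" and lk': "levy_khinchin \<gamma> a' 0 \<sigma>"
  shows "\<nu> = \<sigma> \<and> a = a' \<and> b = 0"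
proof -
  have s: "sets \<sigma> = sets (borel_on {0..<1})" "sets \<nu> = sets (borel_on {0..<1})"
    and int: "\<And>n. integrable \<sigma> (\<lambda>t. 1 - t ^ n)" "\<And>n. integrable \<nu> (\<lambda>t. 1 - t ^ n)"
    and g: "\<And>n. \<gamma> n = a + b * real n + (LINT t|\<nu>. 1 - t ^ n)"
      "\<And>n. \<gamma> n = a' + (LINT t|\<sigma>. 1 - t ^ n)"
    using lk lk' unfolding levy_khinchin_def radon_measure_on_def by auto
  have int1: "integrable \<sigma> (\<lambda>t. 1 - t)" "integrable \<nu> (\<lambda>t. 1 - t)"
    using int[of 1] by auto
  \<comment> \<open>At \<open>n = 0\<close> the linear term and both integrands vanish.\<close>
  have "a = a'" using g(1)[of 0] g(2)[of 0] by simp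
  have m: "(LINT t|\<sigma>. t ^ n * (1 - t)) = b + (LINT t|\<nu>. t ^ n * (1 - t))" for n
    unfolding fdiff_integral_one_minus_power[OF int(1), symmetric]
      fdiff_integral_one_minus_power[OF int(2), symmetric]
    using g(1)[of n] g(2)[of n] g(1)[of "Suc n"] g(2)[of "Suc n"] by (simp add: algebra_simps)
  \<comment> \<open>By \<open>m\<close> this sequence is \<open>b\<close> plus the weighted moments
    of \<nu>, which vanish in the limit; the weighted moments of \<sigma> vanish as well, forcing
    \<open>b = 0\<close>.\<close>
  have "(\<lambda>n. LINT t|\<sigma>. t ^ n * (1 - t)) \<longlonglongrightarrow> b + 0"
    unfolding m by (intro tendsto_add tendsto_const weighted_moments_tendsto_0 s int1)
  then have "b = 0"
    using LIMSEQ_unique[OF _ weighted_moments_tendsto_0[OF s(1) int1(1)]] by simp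
  then have "\<nu> = \<sigma>"
    using m by (intro measure_eqI_weighted_moments s int1) simp
  then show ?thesis using \<open>a = a'\<close> \<open>b = 0\<close> by simp
qed

section \<open>Complete alternation and the weighted shift\<close>

text \<open>The first difference has integrand \<open>t ^ n * (1 - t)\<close>, and each application
  of \<open>nabla\<close> multiplies the integrand by a further factor \<open>1 - t\<close>, so it
  stays nonnegative on \<open>{0..<1}\<close>.\<close>

lemma completely_alternating_levy_khinchin:
  fixes M :: "real measure"
  assumes fin: "finite_measure M" and s: "sets M = sets (borel_on {0..<1})"
  shows "completely_alternating (\<lambda>n. c + (LINT t|M. 1 - t ^ n))"
proof -
  interpret finite_measure M by (rule fin)
  have sp: "space M = {0..<1}" by (rule space_borel_on[OF s])
  have int: "integrable M (\<lambda>t. t ^ n * (1 - t) ^ k)" for n k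
    using sp
    by (intro integrable_bounded_on_space[where B=1] borel_measurable_borel_on[OF s])
      (auto simp: abs_mult intro!: mult_le_one power_le_one)
  have "integrable M (\<lambda>t. 1 - t ^ n)" for n
    using int[of n 0] by simp
  then have fd: "fdiff (\<lambda>n. c + (LINT t|M. 1 - t ^ n)) = (\<lambda>n. LINT t|M. t ^ n * (1 - t))"
    using fdiff_integral_one_minus_power[of M] unfolding fdiff_def by auto
  have "(nabla ^^ k) (\<lambda>n. LINT t|M. t ^ n * (1 - t)) = (\<lambda>n. LINT t|M. t ^ n * (1 - t) ^ Suc k)"
    for k
  proof (induction k)
    case (Suc k)
    \<comment> \<open>As \<open>nabla\<close> is minus the forward difference, the value at
      \<open>Suc n\<close> is subtracted from the value at \<open>n\<close>.\<close>
    have "(LINT t|M. t ^ n * (1 - t) ^ Suc k) - (LINT t|M. t ^ Suc n * (1 - t) ^ Suc k)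
        = (LINT t|M. t ^ n * (1 - t) ^ Suc k - t ^ Suc n * (1 - t) ^ Suc k)" for n
      by (rule Bochner_Integration.integral_diff[symmetric]) (rule int)+
    also have "\<dots> n = (LINT t|M. t ^ n * (1 - t) ^ Suc (Suc k))" for n
      by (rule Bochner_Integration.integral_cong) (simp_all add: algebra_simps)
    finally show ?case using Suc.IH by (simp add: nabla_def fdiff_def)
  qed simp
  then show ?thesis
    unfolding completely_alternating_def completely_monotone_def fd
    using sp by (auto intro!: Bochner_Integration.integral_nonneg)
qed

lemma weighted_shift_image_ell2:
  assumes "\<And>n. (\<alpha> n)\<^sup>2 \<le> C"
  shows "weighted_shift \<alpha> ` ell2 \<subseteq> ell2"
proof safe
  fix x assume "x \<in> ell2"
  then have "summable (\<lambda>n. C * (cmod (x n))\<^sup>2)" by (simp add: ell2_def)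
  \<comment> \<open>The comparison is made from index 1 on, where coordinate \<open>Suc n\<close> of
    the image is a bounded multiple of \<open>x n\<close>; the coordinate at 0 does not affect
    summability.\<close>
  then have "summable (\<lambda>n. (cmod (weighted_shift \<alpha> x (Suc n)))\<^sup>2)"
    by (rule summable_comparison_test_ev[rotated])
      (auto simp: weighted_shift_def norm_mult power_mult_distrib
        intro!: always_eventually mult_right_mono assms)
  then show "weighted_shift \<alpha> x \<in> ell2"
    unfolding ell2_def mem_Collect_eq by (subst (asm) summable_Suc_iff)
qed

text \<open>Squaring removes the roots and the product of quotients telescopes.\<close>

lemma shift_moment_sqrt_quotient:
  assumes "\<And>n. 0 < \<gamma> n"
  shows "shift_moment (\<lambda>n. sqrt (\<gamma> (Suc n) / \<gamma> n)) j = \<gamma> j / \<gamma> 0"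
proof (induction j)
  case 0
  then show ?case using assms[of 0] by (simp add: shift_moment_def)
next
  case (Suc j)
  then show ?case
    using assms[of j] assms[of "Suc j"] by (simp add: shift_moment_def less_imp_le)
qed

theorem theorem3p1:
  fixes \<sigma> :: "real measure" and C :: real and \<mu> :: "real set \<Rightarrow> real"
    and \<gamma> :: "nat \<Rightarrow> real" and \<alpha> :: "nat \<Rightarrow> real"
  assumes "radon_measure_on {0..<1} \<sigma>"
    and "finite_measure \<sigma>"
    and "C = 1 + measure \<sigma> {0..<1}"
    and "\<mu> = (\<lambda>A. C * measure (return (borel_on {0..1}) 1) A - measure \<sigma> (A \<inter> {0..<1}))"
    and "\<gamma> = (\<lambda>n. signed_integral (borel_on {0..1}) \<mu> (\<lambda>t. t ^ n))"
    and "\<alpha> = (\<lambda>n. sqrt (\<gamma> (Suc n) / \<gamma> n))"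
  shows "completely_hyperexpansive_shift (weighted_shift \<alpha>) \<and>
         (\<forall>a b \<nu>. levy_khinchin \<gamma> a b \<nu> \<longleftrightarrow> \<nu> = \<sigma> \<and> a = 1 \<and> b = 0)"
proof -
  have s: "sets \<sigma> = sets (borel_on {0..<1})"
    using assms(1) unfolding radon_measure_on_def by simp
  have sp: "space \<sigma> = {0..<1}" by (rule space_borel_on[OF s])
  interpret finite_measure \<sigma> by (rule assms(2))
  have int: "integrable \<sigma> (\<lambda>t. t ^ n)" for n
    using sp by (intro integrable_bounded_on_space[where B=1] borel_measurable_borel_on[OF s])
      (auto simp: power_le_one)
  have C: "C = 1 + measure \<sigma> (space \<sigma>)" using assms(3) sp by simp
  then have C0: "0 \<le> C" by simp
  have g1: "\<gamma> n = C - (LINT t|\<sigma>. t ^ n)" for n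
    unfolding assms(4,5) by (subst signed_integral_dirac_minus[OF s assms(2) C0]) auto
  \<comment> \<open>The choice of \<open>C\<close> makes this work: its part beyond 1 is the total
    mass of \<sigma>, which combines with the subtracted moment into the integral of
    \<open>1 - t ^ n\<close>.\<close>
  have g: "\<gamma> n = 1 + (LINT t|\<sigma>. 1 - t ^ n)" for n
    using int[of n] by (simp add: g1 C)
  have ge: "1 \<le> \<gamma> n" for n
    unfolding g using sp by (auto intro!: Bochner_Integration.integral_nonneg simp: power_le_one)
  have le: "\<gamma> n \<le> C" for n
    unfolding g1 using sp by (auto intro!: Bochner_Integration.integral_nonneg)
  have pos: "0 < \<gamma> n" for n using ge[of n] by linarith
  have "\<gamma> 0 = 1" by (simp add: g)
  have "completely_hyperexpansive_shift (weighted_shift \<alpha>)"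
    unfolding completely_hyperexpansive_shift_def
  proof (intro exI[of _ \<alpha>] conjI allI refl)
    show "0 < \<alpha> n" for n using pos by (simp add: assms(6))
    \<comment> \<open>All moments lie between 1 and \<open>C\<close>, so the squared weights are
      bounded by \<open>C\<close> and the shift preserves \<open>ell2\<close>.\<close>
    have "\<gamma> (Suc n) / \<gamma> n \<le> C / 1" for n
      using le ge pos C0 by (intro frac_le) auto
    then have "(\<alpha> n)\<^sup>2 \<le> C" for n
      using pos[of n] pos[of "Suc n"] by (simp add: assms(6) less_imp_le)
    then show "weighted_shift \<alpha> ` ell2 \<subseteq> ell2" by (rule weighted_shift_image_ell2)
    have "shift_moment \<alpha> = (\<lambda>n. 1 + (LINT t|\<sigma>. 1 - t ^ n))"
      using shift_moment_sqrt_quotient[of \<gamma>] pos g \<open>\<gamma> 0 = 1\<close> unfolding assms(6) by auto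
    then show "completely_alternating (shift_moment \<alpha>)"
      using completely_alternating_levy_khinchin[OF assms(2) s, of 1] by simp
  qed
  \<comment> \<open>This is the existence half of the equivalence, and also the reference
    representation with zero linear term against which every other one is compared.\<close>
  moreover have "levy_khinchin \<gamma> 1 0 \<sigma>"
    unfolding levy_khinchin_def using assms(1) int g by auto
  ultimately show ?thesis using levy_khinchin_unique by blast
qed

end
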